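(* Let $a,k,n$ be integers with $a>0$ and $n\geq 3$. Let $V_{a,k,n}(\mathbb{Z})$ be the set of integer solutions $\mathbf{x}=(x_1,\dots,x_n)\in\mathbb{Z}^n$ of $$x_1^2+\cdots+x_n^2-a\,x_1x_2\cdots x_n=k,$$ and let $\Gamma_{a,n}$ be the group of maps $\mathbb{Z}^n\to\mathbb{Z}^n$ generated by: - the Vieta involutions $\mathcal{V}_{a,n,i}(x_1,\dots,x_n)=(x_1,\dots,x_{i-1},\,a x_1\cdots x_{i-1}x_{i+1}\cdots x_n-x_i,\,x_{i+1},\dots,x_n)$ for $i=1,\dots,n$; - the double sign changes $\mathcal{S}_{n,s,t}$, which replace $x_s,x_t$ by $-x_s,-x_t$ and fix the other coordinates, for $1\leq s<t\leq n$; - the permutations $\sigma(x_1,\dots,x_n)=(x_{\sigma(1)},\dots,x_{\sigma(n)})$ for $\sigma\in S_n$. Then $\Gamma_{a,n}$ acts on $V_{a,k,n}(\mathbb{Z})$, and the set $$\mathfrak{S}_0(a,k,n)\cup\mathfrak{S}_1(a,k,n)\cup\mathfrak{S}_2(a,k,n)\cup\mathfrak{S}_{>2}(a,k,n)$$ is a fundamental domain for this action, i.e. it contains exactly one point of each $\Gamma_{a,n}$-orbit in $V_{a,k,n}(\mathbb{Z})$. The four sets are as follows. $\mathfrak{S}_0(a,k,n)=\{(0,x_2,\dots,x_n)\in\mathbb{Z}^n:\ 0\leq x_2\leq\cdots\leq x_n,\ x_2^2+\cdots+x_n^2=k\}$. $\mathfrak{S}_1(a,k,n)$: - if $a=1$,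 it is $\{(-1,1,\dots,1,x_{n-1},x_n)\in\mathbb{Z}^n:\ 1\leq x_{n-1}\leq x_n,\ x_{n-1}^2+x_n^2+x_{n-1}x_n=k-n+2\}$; - if $a>1$, it is empty. $\mathfrak{S}_2(a,k,n)$: - if $a=1$, it is $\{(1,\dots,1,2,x_{n-1},x_{n-1})\in\mathbb{Z}^n:\ 2\leq x_{n-1},\ k=n+1\}\cup\{(-1,1,\dots,1,2,x_{n-1},x_n)\in\mathbb{Z}^n:\ 2\leq x_{n-1}\leq x_n,\ x_{n-1}+x_n=\sqrt{k-n-1}\}$; - if $a=2$, it is $\{(1,\dots,1,x_{n-1},x_{n-1})\in\mathbb{Z}^n:\ 1\leq x_{n-1},\ k=n-2\}\cup\{(-1,1,\dots,1,x_{n-1},x_n)\in\mathbb{Z}^n:\ 1\leq x_{n-1}\leq x_n,\ x_{n-1}+x_n=\sqrt{k-n+2}\}$; - if $a>2$, it is empty. $\mathfrak{S}_{>2}(a,k,n)$ is the union of $$\Big\{\mathbf{x}\in V_{a,k,n}(\mathbb{Z}):\ 0<x_1\leq\cdots\leq x_n\leq \tfrac{a}{2}x_1\cdots x_{n-1}\ \text{and}\ a x_1\cdots x_{n-2}>2\Big\}$$ and $$\{\mathbf{x}\in V_{a,k,n}(\mathbb{Z}):\ 0<-x_1\leq x_2\leq\cdots\leq x_n\ \text{and}\ a x_1\cdots x_{n-2}<-2\}.$$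
   Context: In the displayed tuples, "$1,\dots,1$" denotes the appropriate number of entries equal to $1$ so that the tuple lies in $\mathbb{Z}^n$.
   Formalization: For n=3 and a=1 the tuple (-1,1,…,1,2,x_{n-1},x_n) in the second family of S_2 does not fit in Z^3; it is read there as (-2,x_2,x_3). Reading that family as empty makes the claim false (k=20, point (-2,2,2)). *)

theory Defs
  imports "HOL-Algebra.Generated_Groups" "HOL-Algebra.Group_Action"
    "HOL-Combinatorics.Permutations" Complex_Main
begin

text \<open>A point \<open>(x\<^sub>1, \<dots>, x\<^sub>n)\<close> of \<open>\<int>\<^sup>n\<close> is an integer list of length \<open>n\<close>;
  list positions start at 0, so the coordinate \<open>x\<^sub>i\<close> is \<open>x ! (i - 1)\<close>.\<close>

definition Zn :: "nat \<Rightarrow> int list set" where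
  "Zn n = {x. length x = n}"

definition V :: "int \<Rightarrow> int \<Rightarrow> nat \<Rightarrow> int list set" where
  "V a k n = {x \<in> Zn n. (\<Sum>i<n. (x ! i)\<^sup>2) - a * (\<Prod>i<n. x ! i) = k}"

definition vieta :: "int \<Rightarrow> nat \<Rightarrow> nat \<Rightarrow> int list \<Rightarrow> int list" where
  "vieta a n i x = x[i := a * (\<Prod>j\<in>{..<n} - {i}. x ! j) - x ! i]"

definition double_sign :: "nat \<Rightarrow> nat \<Rightarrow> int list \<Rightarrow> int list" where
  "double_sign s t x = x[s := - (x ! s), t := - (x ! t)]"

text \<open>Elements of \<^const>\<open>BijGroup\<close> are extensional functions, hence the restrictions
  of the generators to \<open>\<int>\<^sup>n\<close>.\<close>

definition Gamma_generators :: "int \<Rightarrow> nat \<Rightarrow> (int list \<Rightarrow> int list) set" where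
  "Gamma_generators a n =
     {restrict (vieta a n i) (Zn n) | i. i < n} \<union>
     {restrict (double_sign s t) (Zn n) | s t. s < t \<and> t < n} \<union>
     {restrict (permute_list \<sigma>) (Zn n) | \<sigma>. \<sigma> permutes {..<n}}"

definition Gamma :: "int \<Rightarrow> nat \<Rightarrow> (int list \<Rightarrow> int list) monoid" where
  "Gamma a n =
     (BijGroup (Zn n))\<lparr>carrier := generate (BijGroup (Zn n)) (Gamma_generators a n)\<rparr>"

definition fundamental_domain ::
    "('g, 'm) monoid_scheme \<Rightarrow> 'b set \<Rightarrow> ('g \<Rightarrow> 'b \<Rightarrow> 'b) \<Rightarrow> 'b set \<Rightarrow> bool" where
  "fundamental_domain G E \<phi> D \<longleftrightarrow> D \<subseteq> E \<and> (\<forall>B\<in>orbits G E \<phi>. \<exists>!x. x \<in> B \<and> x \<in> D)"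

definition S0 :: "int \<Rightarrow> int \<Rightarrow> nat \<Rightarrow> int list set" where
  "S0 a k n = {0 # xs | xs. length xs = n - 1 \<and> sorted (0 # xs) \<and> (\<Sum>x\<leftarrow>xs. x\<^sup>2) = k}"

definition S1 :: "int \<Rightarrow> int \<Rightarrow> nat \<Rightarrow> int list set" where
  "S1 a k n =
     (if a = 1 then
        {-1 # replicate (n - 3) 1 @ [y, z] | y z.
           1 \<le> y \<and> y \<le> z \<and> y\<^sup>2 + z\<^sup>2 + y * z = k - int n + 2}
      else {})"

text \<open>For \<open>a = 1\<close>, the second family \<open>(-1, 1, \<dots>, 1, 2, x\<^sub>n\<^sub>-\<^sub>1, x\<^sub>n)\<close> of \<open>S2\<close> as displayed needs
  at least four coordinates. Its first \<open>n - 2\<close> entries are \<open>(1, \<dots>, 1, 2)\<close> with the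
  sign of the first one changed, which for \<open>n = 3\<close> gives \<open>(-2, x\<^sub>2, x\<^sub>3)\<close>.

  The function \<^const>\<open>sqrt\<close> is odd, so its value at a negative number is negative; the positive
  integer \<open>y + z\<close> therefore equals the square root only if the radicand is positive.\<close>

definition S2 :: "int \<Rightarrow> int \<Rightarrow> nat \<Rightarrow> int list set" where
  "S2 a k n =
     (if a = 1 then
        {replicate (n - 3) 1 @ [2, y, y] | y. 2 \<le> y \<and> k = int n + 1} \<union>
        {(if n = 3 then [-2] else -1 # replicate (n - 4) 1 @ [2]) @ [y, z] | y z.
           2 \<le> y \<and> y \<le> z \<and> real_of_int (y + z) = sqrt (real_of_int (k - int n - 1))}
      else if a = 2 then
        {replicate (n - 2) 1 @ [y, y] | y. 1 \<le> y \<and> k = int n - 2} \<union>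
        {-1 # replicate (n - 3) 1 @ [y, z] | y z.
           1 \<le> y \<and> y \<le> z \<and> real_of_int (y + z) = sqrt (real_of_int (k - int n + 2))}
      else {})"

definition S_gt2 :: "int \<Rightarrow> int \<Rightarrow> nat \<Rightarrow> int list set" where
  "S_gt2 a k n =
     {x \<in> V a k n. 0 < x ! 0 \<and> sorted x \<and>
        real_of_int (x ! (n - 1)) \<le> real_of_int a / 2 * real_of_int (\<Prod>i<n - 1. x ! i) \<and>
        a * (\<Prod>i<n - 2. x ! i) > 2} \<union>
     {x \<in> V a k n. 0 < - (x ! 0) \<and> sorted (x[0 := - (x ! 0)]) \<and>
        a * (\<Prod>i<n - 2. x ! i) < -2}"

end

theory Submission
  imports Defs "HOL-Library.Confluence"
begin

text \<open>Permutations and double sign changes preserve the multiset of absolute values of the entries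
  and their product; together these two data (the profile) determine the orbit under these
  symmetries. Vieta moves that lower an absolute value define a terminating rewriting relation on
  profiles. Two different descents from the same profile exist only if \<open>a\<close> times the product of
  the other \<open>n - 2\<close> entries is \<open>\<plusminus>1\<close>, and then one of the two results descends to the other or
  coincides with it. So the relation is strongly confluent, and each orbit contains exactly one
  irreducible profile. The four sets of the theorem collect the representatives \<open>x\<close> of these
  profiles with \<open>\<bar>x\<^sub>1\<bar> \<le> x\<^sub>2 \<le> \<dots> \<le> x\<^sub>n\<close>, split according to whether \<open>\<bar>a x\<^sub>1 \<dots> x\<^sub>n\<^sub>-\<^sub>2\<bar>\<close> is
  0, 1, 2 or larger: such an \<open>x\<close> is irreducible iff the product of its entries is at most 0 or
  \<open>2 x\<^sub>n \<le> a x\<^sub>1 \<dots> x\<^sub>n\<^sub>-\<^sub>1\<close>.\<close>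

subsection \<open>Products of lists\<close>

lemma prod_nth_eq_prod_list: "(\<Prod>i<length xs. xs ! i) = prod_list (xs :: 'a :: comm_monoid_mult list)"
proof (induction xs)
  case (Cons x xs)
  then show ?case
    by (simp add: prod.lessThan_Suc_shift del: prod.lessThan_Suc)
qed simp

lemma prod_list_update:
  fixes xs :: "'a :: comm_monoid_mult list"
  assumes "i < length xs"
  shows "prod_list (xs[i := e]) = e * prod_list (xs[i := 1])"
  using assms by (simp add: upd_conv_take_nth_drop ac_simps)

lemma prod_list_remove:
  fixes xs :: "'a :: comm_monoid_mult list"
  assumes "i < length xs"
  shows "prod_list xs = xs ! i * prod_list (xs[i := 1])"
  using prod_list_update [OF assms, of "xs ! i"] by simp

lemma prod_nth_remove_eq_prod_list:
  fixes xs :: "'a :: comm_monoid_mult list"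
  assumes "i < length xs"
  shows "(\<Prod>j\<in>{..<length xs} - {i}. xs ! j) = prod_list (xs[i := 1])"
proof -
  have "prod_list (xs[i := 1]) = (\<Prod>j<length xs. xs[i := 1] ! j)"
    using prod_nth_eq_prod_list [of "xs[i := 1]"] by simp
  also have "\<dots> = xs[i := 1] ! i * (\<Prod>j\<in>{..<length xs} - {i}. xs[i := 1] ! j)"
    using assms by (intro prod.remove) auto
  also have "\<dots> = (\<Prod>j\<in>{..<length xs} - {i}. xs ! j)"
    using assms by (auto intro!: prod.cong)
  finally show ?thesis ..
qed

lemma abs_prod_list: "\<bar>prod_list xs\<bar> = prod_list (map abs (xs :: 'a :: linordered_idom list))"
  by (induction xs) (simp_all add: abs_mult)

subsection \<open>Profiles and descent\<close>

definition partner :: "int \<Rightarrow> int list \<Rightarrow> nat \<Rightarrow> int" where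
  "partner a x i = a * prod_list (x[i := 1]) - x ! i"

lemma vieta_eq: "length x = n \<Longrightarrow> i < n \<Longrightarrow> vieta a n i x = x[i := partner a x i]"
  using prod_nth_remove_eq_prod_list [of i x] by (auto simp: vieta_def partner_def)

definition profile :: "int list \<Rightarrow> int multiset \<times> int" where
  "profile x = (mset (map abs x), prod_list x)"

lemma profile_eq_iff: "profile x = profile y \<longleftrightarrow> mset (map abs x) = mset (map abs y) \<and> prod_list x = prod_list y"
  by (simp add: profile_def)

definition descent :: "int \<Rightarrow> int multiset \<times> int \<Rightarrow> int multiset \<times> int \<Rightarrow> bool" where
  "descent a p q \<longleftrightarrow> (\<exists>x i. i < length x \<and> p = profile x \<and> q = profile (x[i := partner a x i]) \<and>
     \<bar>partner a x i\<bar> < \<bar>x ! i\<bar>)"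

lemma profile_partner_transport:
  assumes eq: "profile x = profile y" and i: "i < length y"
  obtains j where "j < length x" "\<bar>x ! j\<bar> = \<bar>y ! i\<bar>" "\<bar>partner a x j\<bar> = \<bar>partner a y i\<bar>"
    "profile (x[j := partner a x j]) = profile (y[i := partner a y i])"
proof -
  have m: "mset (map abs x) = mset (map abs y)" and p: "prod_list x = prod_list y"
    using eq by (simp_all add: profile_eq_iff)
  have "\<bar>y ! i\<bar> \<in> set (map abs y)"
    using i by auto
  then have "\<bar>y ! i\<bar> \<in> set (map abs x)"
    using m by (metis set_mset_mset)
  then obtain j where j: "j < length x" and xj: "\<bar>x ! j\<bar> = \<bar>y ! i\<bar>"
    by (auto simp: in_set_conv_nth)
  define r s where "r = prod_list (x[j := 1])" and "s = prod_list (y[i := 1])"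
  have upd: "mset (map abs (x[j := e])) = mset (map abs (y[i := f]))" if "\<bar>e\<bar> = \<bar>f\<bar>" for e f
    using i j m xj that by (simp add: map_update mset_update)
  have rs: "\<bar>r\<bar> = \<bar>s\<bar>"
    unfolding r_def s_def abs_prod_list using upd [of 1 1] by (metis prod_mset_prod_list)
  have px: "x ! j * r = y ! i * s"
    using p prod_list_remove [OF i] prod_list_remove [OF j] by (simp add: r_def s_def)
  have "\<bar>partner a x j\<bar> = \<bar>partner a y i\<bar> \<and> partner a x j * r = partner a y i * s"
  proof (cases "y ! i = 0")
    case True
    then have "x ! j = 0"
      using xj by simp
    moreover have "r * r = s * s"
      using rs by (metis abs_mult_self_eq)
    ultimately show ?thesis
      using True rs by (simp add: partner_def abs_mult flip: r_def s_def)
  next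
    case False
    then consider "x ! j = y ! i" "r = s" | "x ! j = - (y ! i)" "r = - s"
      using px xj by (auto simp: abs_eq_iff) (metis minus_minus mult_cancel_left mult_minus_right)
    then show ?thesis
      by cases (simp_all add: partner_def algebra_simps flip: r_def s_def)
  qed
  then show ?thesis
    using upd prod_list_update [OF i, of "partner a y i"] prod_list_update [OF j, of "partner a x j"]
    by (intro that [OF j xj]) (auto simp: profile_eq_iff r_def s_def)
qed

lemma partner_less_iff:
  assumes a: "a > 0" and i: "i < length x"
  shows "\<bar>partner a x i\<bar> < \<bar>x ! i\<bar> \<longleftrightarrow> 0 < prod_list x \<and> a * prod_list x < 2 * (x ! i)\<^sup>2"
proof -
  define u r where "u = x ! i" and "r = prod_list (x[i := 1])"
  have p: "prod_list x = u * r"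
    using prod_list_remove [OF i] by (simp add: u_def r_def)
  have "\<bar>partner a x i\<bar> < \<bar>x ! i\<bar> \<longleftrightarrow> (a * r - u)\<^sup>2 < u\<^sup>2"
    by (simp add: partner_def u_def r_def abs_le_square_iff flip: not_le)
  also have "\<dots> \<longleftrightarrow> a * (a * r\<^sup>2) < a * (2 * (u * r))"
    by (simp add: power2_eq_square algebra_simps)
  also have "\<dots> \<longleftrightarrow> a * r\<^sup>2 < 2 * (u * r)"
    using a by (subst mult_less_cancel_left_pos) auto
  also have "\<dots> \<longleftrightarrow> 0 < u * r \<and> a * (u * r) < 2 * u\<^sup>2"
  proof (cases "0 < u * r")
    case True
    then have "r \<noteq> 0" "u \<noteq> 0" by auto
    then have "a * r\<^sup>2 < 2 * (u * r) \<longleftrightarrow> u\<^sup>2 * (a * r\<^sup>2) < u\<^sup>2 * (2 * (u * r))"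
      by (subst mult_less_cancel_left_pos) auto
    also have "\<dots> \<longleftrightarrow> (u * r) * (a * (u * r)) < (u * r) * (2 * u\<^sup>2)"
      by (simp add: power2_eq_square algebra_simps)
    also have "\<dots> \<longleftrightarrow> a * (u * r) < 2 * u\<^sup>2"
      using True by (subst mult_less_cancel_left_pos) auto
    finally show ?thesis using True by simp
  next
    case False
    moreover have "0 \<le> a * r\<^sup>2" using a by simp
    ultimately show ?thesis by auto
  qed
  finally show ?thesis
    by (simp add: p u_def)
qed

lemma prod_list_update2:
  fixes xs :: "'a :: comm_monoid_mult list"
  assumes "i < length xs" "j < length xs" "i \<noteq> j"
  shows "prod_list (xs[i := e, j := f]) = e * f * prod_list (xs[i := 1, j := 1])"
  using assms prod_list_update [of j "xs[i := e]" f] prod_list_update [of i "xs[j := 1]" e]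
  by (simp add: list_update_swap ac_simps)

lemma profile_swap:
  assumes "i < length x" "j < length x" "i \<noteq> j" "\<bar>\<alpha>\<bar> = \<bar>\<gamma>\<bar>" "\<bar>\<beta>\<bar> = \<bar>\<delta>\<bar>" "\<alpha> * \<beta> = \<gamma> * \<delta>"
  shows "profile (x[i := \<alpha>, j := \<beta>]) = profile (x[i := \<delta>, j := \<gamma>])"
proof -
  have "map abs (x[i := \<delta>, j := \<gamma>]) = (map abs x)[i := \<bar>\<beta>\<bar>, j := \<bar>\<alpha>\<bar>]"
    using assms by (simp add: map_update)
  also have "mset \<dots> = mset ((map abs x)[i := \<bar>\<alpha>\<bar>, j := \<bar>\<beta>\<bar>])"
    using assms mset_swap [of i "(map abs x)[i := \<bar>\<alpha>\<bar>, j := \<bar>\<beta>\<bar>]" j]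
    by (simp add: list_update_swap)
  finally have m: "mset (map abs (x[i := \<alpha>, j := \<beta>])) = mset (map abs (x[i := \<delta>, j := \<gamma>]))"
    by (simp add: map_update)
  show ?thesis
    using m prod_list_update2 [OF assms(1-3), of \<alpha> \<beta>]
      prod_list_update2 [OF assms(1-3), of \<delta> \<gamma>] assms(6)
    by (metis profile_eq_iff mult.commute)
qed

text \<open>If the moves at \<open>i \<noteq> j\<close> both descend, then \<open>a\<close> times the product of the other entries is
  smaller than 2 in absolute value, hence equal to \<open>\<plusminus>1\<close>. After the move at \<open>i\<close>, the move at \<open>j\<close>
  then descends to the same profile as the move at \<open>j\<close> alone.\<close>

lemma descent_peak:
  assumes a: "a > 0" and i: "i < length x" and j: "j < length x" and ij: "i \<noteq> j"
    and di: "\<bar>partner a x i\<bar> < \<bar>x ! i\<bar>" and dj: "\<bar>partner a x j\<bar> < \<bar>x ! j\<bar>"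
    and le: "\<bar>x ! i\<bar> \<le> \<bar>x ! j\<bar>"
  shows "(descent a)\<^sup>=\<^sup>= (profile (x[i := partner a x i])) (profile (x[j := partner a x j]))"
proof -
  define u w q where "u = x ! i" and "w = x ! j" and "q = a * prod_list (x[i := 1, j := 1])"
  have pi: "prod_list (x[i := 1]) = w * prod_list (x[i := 1, j := 1])"
    using prod_list_remove [of j "x[i := 1]"] i j ij by (simp add: w_def)
  have pj: "prod_list (x[j := 1]) = u * prod_list (x[i := 1, j := 1])"
    using prod_list_remove [of i "x[j := 1]"] i j ij by (simp add: u_def list_update_swap)
  have ui: "partner a x i = q * w - u" and wj: "partner a x j = q * u - w"
    by (simp_all add: partner_def pi pj u_def w_def q_def)
  have "0 < prod_list x" and lti: "a * prod_list x < 2 * u\<^sup>2" and ltj: "a * prod_list x < 2 * w\<^sup>2"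
    using di dj partner_less_iff [OF a] i j by (auto simp: u_def w_def)
  moreover have apq: "a * prod_list x = q * u * w"
    using prod_list_remove [OF i] by (simp add: pi u_def q_def)
  ultimately have pos: "0 < q * u * w"
    using a by (metis mult_pos_pos)
  have "(q * u * w) * (q * u * w) < (2 * u\<^sup>2) * (2 * w\<^sup>2)"
    using lti ltj pos unfolding apq by (metis mult_strict_mono' order_less_imp_le)
  then have "(u\<^sup>2 * w\<^sup>2) * q\<^sup>2 < (u\<^sup>2 * w\<^sup>2) * 2\<^sup>2"
    by (simp add: power2_eq_square algebra_simps)
  moreover have "0 < u\<^sup>2 * w\<^sup>2"
    using pos by (auto simp: zero_less_mult_iff)
  ultimately have "q\<^sup>2 < 2\<^sup>2"
    using mult_less_cancel_left_pos by blast
  then have "\<bar>q\<bar> < 2"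
    using abs_le_square_iff [of 2 q] by simp
  moreover have "q \<noteq> 0" using pos by auto
  ultimately have q: "q = 1 \<or> q = - 1" by auto
  then have qq: "q * q = 1" "\<bar>q\<bar> = 1" by auto
  define y where "y = x[i := partner a x i]"
  have y_upd: "y = x[i := q * w - u]" and len: "length y = length x" and y_j: "y ! j = w"
    using ij by (simp_all add: y_def ui w_def)
  have "prod_list (y[j := 1]) = (q * w - u) * prod_list (x[i := 1, j := 1])"
    using prod_list_update [of i "x[j := 1]" "q * w - u"] i ij
    by (simp add: y_upd list_update_swap)
  then have "partner a y j = q * (q * w - u) - w"
    by (simp add: partner_def y_j q_def)
  also have "\<dots> = (q * q) * w - q * u - w"
    by (simp only: algebra_simps)
  finally have yj: "partner a y j = - (q * u)"
    by (simp add: qq)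
  have wj': "partner a x j = - (q * (q * w - u))"
    using qq by (auto simp: wj algebra_simps)
  show ?thesis
  proof (cases "\<bar>u\<bar> = \<bar>w\<bar>")
    case True
    then have "q * w = u"
      using q pos by (auto simp: abs_eq_iff mult_less_0_iff)
    then have "profile (x[i := 0, j := w]) = profile (x[i := u, j := 0])"
      using True i j ij by (intro profile_swap) auto
    moreover have "x[i := 0, j := w] = x[i := 0]"
      using ij by (metis list_update_id nth_list_update_neq w_def)
    moreover have "x[i := u, j := 0] = x[j := 0]"
      by (simp add: u_def)
    ultimately show ?thesis
      using \<open>q * w = u\<close> by (simp add: ui wj')
  next
    case False
    then have "\<bar>partner a y j\<bar> < \<bar>y ! j\<bar>"
      using le qq by (simp add: yj y_j abs_mult u_def w_def)
    then have "descent a (profile y) (profile (y[j := partner a y j]))"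
      using j len unfolding descent_def by metis
    also have "profile (y[j := partner a y j]) = profile (x[i := u, j := partner a x j])"
      unfolding y_upd using i j ij qq yj [unfolded y_upd]
      by (simp only: wj', intro profile_swap) (simp_all add: abs_mult)
    finally show ?thesis
      by (simp add: y_def u_def)
  qed
qed

lemma strong_confluentp_descent:
  assumes a: "a > 0"
  shows "strong_confluentp (descent a)"
proof
  fix p q r
  assume "descent a p q" "descent a p r"
  then obtain x i y l where x: "i < length x" "p = profile x" "q = profile (x[i := partner a x i])"
      "\<bar>partner a x i\<bar> < \<bar>x ! i\<bar>"
    and y: "l < length y" "p = profile y" "r = profile (y[l := partner a y l])"
      "\<bar>partner a y l\<bar> < \<bar>y ! l\<bar>"
    unfolding descent_def by blast
  obtain j where j: "j < length x" "r = profile (x[j := partner a x j])"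
      "\<bar>partner a x j\<bar> < \<bar>x ! j\<bar>"
    using profile_partner_transport [of x y l] x y by metis
  have "(descent a)\<^sup>=\<^sup>= q r \<or> (descent a)\<^sup>=\<^sup>= r q"
  proof (cases "i = j")
    case True
    then show ?thesis
      using x j by simp
  next
    case False
    then show ?thesis
      using descent_peak [OF a, of i x j] descent_peak [OF a, of j x i] x j
      by (metis linorder_le_cases)
  qed
  then show "\<exists>u. (descent a)\<^sup>*\<^sup>* q u \<and> (descent a)\<^sup>=\<^sup>= r u"
    by (metis r_into_rtranclp rtranclp.rtrancl_refl sup2CI sup2E)
qed

lemma descent_normal_form_unique:
  assumes "a > 0" and "equivclp (descent a) p q"
    and "\<And>r. \<not> descent a p r" and "\<And>r. \<not> descent a q r"
  shows "p = q"
proof -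
  have "semiconfluentp (descent a)"
    using assms(1) by (intro strong_confluentp_into_semiconfluentp strong_confluentp_descent)
  then have "((descent a)\<^sup>*\<^sup>* OO (descent a)\<inverse>\<inverse>\<^sup>*\<^sup>*) p q"
    using assms(2) by (simp add: semiconfluentp_equivclp)
  then show ?thesis
    using assms(3,4) unfolding rtranclp_conversep
    by (metis conversep_iff converse_rtranclpE relcomppE)
qed

subsection \<open>The generators\<close>

lemma V_iff: "x \<in> V a k n \<longleftrightarrow> length x = n \<and> (\<Sum>u\<leftarrow>x. u\<^sup>2) - a * prod_list x = k"
proof -
  have "(\<Sum>u\<leftarrow>x. u\<^sup>2) = (\<Sum>i<length x. (x ! i)\<^sup>2)"
    by (simp add: sum_list_sum_nth atLeast0LessThan)
  then show ?thesis
    by (auto simp: V_def Zn_def prod_nth_eq_prod_list)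
qed

lemma V_subset_Zn: "V a k n \<subseteq> Zn n"
  by (auto simp: V_def)

lemma profile_eq_lengthD: "profile x = profile y \<Longrightarrow> length x = length y"
  by (metis length_map profile_eq_iff size_mset)

lemma profile_eq_V:
  assumes "profile x = profile y"
  shows "x \<in> V a k n \<longleftrightarrow> y \<in> V a k n"
proof -
  have "(\<Sum>u\<leftarrow>z. u\<^sup>2) = sum_mset (image_mset power2 (mset (map abs z)))" for z :: "int list"
    by (simp add: sum_mset_sum_list [symmetric] multiset.map_comp comp_def flip: mset_map)
  then show ?thesis
    using assms profile_eq_lengthD [OF assms] by (simp add: V_iff profile_eq_iff)
qed

lemma vieta_in_V:
  assumes i: "i < n" and x: "x \<in> Zn n"
  shows "vieta a n i x \<in> V a k n \<longleftrightarrow> x \<in> V a k n"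
proof -
  have l: "i < length x" using assms by (simp add: Zn_def)
  define u r where "u = x ! i" and "r = prod_list (x[i := 1])"
  have sq: "(\<Sum>v\<leftarrow>x[i := e]. v\<^sup>2) = e\<^sup>2 + (\<Sum>v\<leftarrow>x[i := 0]. v\<^sup>2)" for e
    using l by (simp add: upd_conv_take_nth_drop)
  define F where "F y = (\<Sum>v\<leftarrow>y. v\<^sup>2) - a * prod_list y" for y
  have F: "F (x[i := e]) = e\<^sup>2 - a * (e * r) + (\<Sum>v\<leftarrow>x[i := 0]. v\<^sup>2)" for e
    using sq [of e] prod_list_update [OF l, of e] by (simp add: F_def r_def)
  have "F (x[i := a * r - u]) = F (x[i := u])"
    unfolding F by (simp add: power2_eq_square algebra_simps)
  then have "F (vieta a n i x) = F x"
    using l x by (simp add: vieta_eq Zn_def partner_def u_def r_def)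
  then show ?thesis
    using x by (simp add: V_iff F_def Zn_def vieta_def)
qed

lemma vieta_vieta:
  assumes "i < n" "x \<in> Zn n"
  shows "vieta a n i (vieta a n i x) = x"
  using assms by (simp add: vieta_eq Zn_def partner_def)

lemma double_sign_double_sign:
  assumes "s < t" "t < n" "x \<in> Zn n"
  shows "double_sign s t (double_sign s t x) = x"
  using assms by (auto simp: double_sign_def Zn_def nth_list_update intro!: nth_equalityI)

lemma profile_double_sign:
  assumes "s < t" "t < n" "x \<in> Zn n"
  shows "profile (double_sign s t x) = profile x"
proof -
  have l: "s < length x" "t < length x" "s \<noteq> t"
    using assms by (auto simp: Zn_def)
  have "map abs (double_sign s t x) = map abs (x[s := x ! s, t := x ! t])"
    unfolding double_sign_def map_update by simp
  moreover have "prod_list (double_sign s t x) = prod_list (x[s := x ! s, t := x ! t])"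
    using prod_list_update2 [OF l, of "- (x ! s)" "- (x ! t)"] prod_list_update2 [OF l, of "x ! s" "x ! t"]
    by (simp add: double_sign_def)
  ultimately show ?thesis
    by (simp add: profile_def)
qed

lemma profile_permute_list:
  assumes "\<sigma> permutes {..<n}" "x \<in> Zn n"
  shows "profile (permute_list \<sigma> x) = profile x"
  using assms by (auto simp: profile_eq_iff Zn_def simp flip: prod_mset_prod_list)

lemma involution_in_Bij:
  assumes "\<And>x. x \<in> S \<Longrightarrow> f x \<in> S" "\<And>x. x \<in> S \<Longrightarrow> f (f x) = x"
  shows "restrict f S \<in> Bij S"
proof -
  have "bij_betw f S S"
    by (rule bij_betw_byWitness [where f' = f]) (use assms in auto)
  then show ?thesis
    by (simp add: Bij_def)
qed

lemma permute_list_in_Bij: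
  assumes "\<sigma> permutes {..<n}"
  shows "restrict (permute_list \<sigma>) (Zn n) \<in> Bij (Zn n)"
proof -
  have "permute_list \<sigma> (permute_list (inv_into UNIV \<sigma>) x) = x \<and> permute_list (inv_into UNIV \<sigma>) (permute_list \<sigma> x) = x"
    if "x \<in> Zn n" for x
    using that assms permutes_inv [OF assms] permutes_inv_o [OF assms]
    by (simp add: Zn_def flip: permute_list_compose)
  then have "bij_betw (permute_list \<sigma>) (Zn n) (Zn n)"
    by (intro bij_betw_byWitness [where f' = "permute_list (inv_into UNIV \<sigma>)"]) (auto simp: Zn_def)
  then show ?thesis
    by (simp add: Bij_def)
qed

lemma Gamma_generators_subset_Bij: "Gamma_generators a n \<subseteq> Bij (Zn n)"
proof -
  have "restrict (vieta a n i) (Zn n) \<in> Bij (Zn n)" if "i < n" for i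
    using that by (intro involution_in_Bij vieta_vieta) (auto simp: Zn_def vieta_def)
  moreover have "restrict (double_sign s t) (Zn n) \<in> Bij (Zn n)" if "s < t" "t < n" for s t
    using that by (intro involution_in_Bij double_sign_double_sign) (auto simp: Zn_def double_sign_def)
  ultimately show ?thesis
    using permute_list_in_Bij by (auto simp: Gamma_generators_def)
qed

subsection \<open>The action of the generated group\<close>

lemma BijGroup_simps:
  "carrier (BijGroup S) = Bij S" "\<one>\<^bsub>BijGroup S\<^esub> = (\<lambda>x\<in>S. x)"
  "f \<in> Bij S \<Longrightarrow> g \<in> Bij S \<Longrightarrow> f \<otimes>\<^bsub>BijGroup S\<^esub> g = compose S f g"
  by (simp_all add: BijGroup_def)

lemma generate_BijGroup_rel:
  assumes H: "H \<subseteq> Bij S" and R: "equivp R"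
    and rel: "\<And>h x. h \<in> H \<Longrightarrow> x \<in> S \<Longrightarrow> R x (h x)"
    and g: "g \<in> generate (BijGroup S) H" and x: "x \<in> S"
  shows "R x (g x)"
  using g x
proof (induction arbitrary: x rule: generate.induct)
  case one
  then show ?case
    using R by (simp add: BijGroup_simps equivp_reflp)
next
  case (incl h)
  then show ?case
    by (rule rel)
next
  case (inv h)
  interpret group "BijGroup S" by (rule group_BijGroup)
  have h: "h \<in> Bij S"
    using inv H by auto
  have ih: "inv\<^bsub>BijGroup S\<^esub> h \<in> Bij S"
    using h inv_closed [of h] by (simp add: BijGroup_simps)
  define y where "y = (inv\<^bsub>BijGroup S\<^esub> h) x"
  have y: "y \<in> S"
    using Bij_imp_funcset [OF ih] inv by (auto simp: y_def)
  have "h y = (h \<otimes>\<^bsub>BijGroup S\<^esub> inv\<^bsub>BijGroup S\<^esub> h) x"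
    using h ih inv by (simp add: BijGroup_simps y_def compose_eq)
  also have "\<dots> = x"
    using h inv by (simp add: BijGroup_simps)
  finally have "h y = x" .
  then show ?case
    using rel [OF inv(1) y] R by (simp add: y_def equivp_symp)
next
  case (eng g h)
  have gh: "g \<in> Bij S" "h \<in> Bij S"
    using eng group.generate_in_carrier [OF group_BijGroup, of H S] H by (auto simp: BijGroup_simps)
  then have "h x \<in> S"
    using Bij_imp_funcset eng by blast
  then show ?case
    using eng gh equivp_transp [OF R] by (simp add: BijGroup_simps compose_eq) blast
qed

lemma group_action_restrict:
  assumes H: "subgroup H (BijGroup S)" and ES: "E \<subseteq> S"
    and inv: "\<And>g x. g \<in> H \<Longrightarrow> x \<in> S \<Longrightarrow> g x \<in> E \<longleftrightarrow> x \<in> E"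
  shows "group_action ((BijGroup S)\<lparr>carrier := H\<rparr>) E (\<lambda>g. restrict g E)"
proof -
  have HB: "H \<subseteq> Bij S"
    using subgroup.subset [OF H] by (simp add: BijGroup_simps)
  have B: "restrict g E \<in> Bij E" if g: "g \<in> H" for g
  proof -
    have bij: "bij_betw g S S"
      using g HB by (auto simp: Bij_def)
    have "inj_on g E"
      using bij ES by (auto simp: bij_betw_def intro: inj_on_subset)
    moreover have "g ` E = E"
    proof
      show "g ` E \<subseteq> E"
        using inv [OF g] ES by auto
      show "E \<subseteq> g ` E"
      proof
        fix y assume y: "y \<in> E"
        then obtain x where "x \<in> S" "y = g x"
          using bij ES by (auto simp: bij_betw_def)
        then show "y \<in> g ` E"
          using inv [OF g] y by auto
      qed
    qed
    ultimately show ?thesis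
      by (simp add: Bij_def bij_betw_def)
  qed
  have "restrict (g \<otimes>\<^bsub>BijGroup S\<^esub> h) E = restrict g E \<otimes>\<^bsub>BijGroup E\<^esub> restrict h E"
    if "g \<in> H" "h \<in> H" for g h
  proof -
    have "restrict (compose S g h) E = compose E (restrict g E) (restrict h E)"
      using ES inv [of h] that by (auto simp: fun_eq_iff restrict_def compose_def)
    then show ?thesis
      using that HB B by (auto simp: BijGroup_simps subset_iff)
  qed
  then have "(\<lambda>g. restrict g E) \<in> hom ((BijGroup S)\<lparr>carrier := H\<rparr>) (BijGroup E)"
    using B by (auto simp: hom_def BijGroup_simps)
  then show ?thesis
    using group_BijGroup [of S] group_BijGroup [of E] subgroup.subgroup_is_group [OF H]
    by (simp add: group_action_def group_hom_def group_hom_axioms_def)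
qed

lemma carrier_Gamma: "carrier (Gamma a n) = generate (BijGroup (Zn n)) (Gamma_generators a n)"
  by (simp add: Gamma_def)

lemma subgroup_Gamma: "subgroup (carrier (Gamma a n)) (BijGroup (Zn n))"
  unfolding carrier_Gamma
  by (intro group.generate_is_subgroup group_BijGroup)
     (simp add: BijGroup_simps Gamma_generators_subset_Bij)

lemma Gamma_rel:
  assumes "equivp R" "g \<in> carrier (Gamma a n)" "x \<in> Zn n"
    and "\<And>i x. i < n \<Longrightarrow> x \<in> Zn n \<Longrightarrow> R x (vieta a n i x)"
    and "\<And>x y. profile x = profile y \<Longrightarrow> R x y"
  shows "R x (g x)"
proof (rule generate_BijGroup_rel [OF Gamma_generators_subset_Bij assms(1)])
  show "g \<in> generate (BijGroup (Zn n)) (Gamma_generators a n)"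
    using assms(2) by (simp add: carrier_Gamma)
  show "R x (h x)" if "h \<in> Gamma_generators a n" "x \<in> Zn n" for h x
    using that assms(4) assms(5) [OF profile_double_sign [symmetric]]
      assms(5) [OF profile_permute_list [symmetric]]
    by (auto simp: Gamma_generators_def)
qed fact

lemma Gamma_V:
  assumes "g \<in> carrier (Gamma a n)" "x \<in> Zn n"
  shows "g x \<in> V a k n \<longleftrightarrow> x \<in> V a k n"
proof -
  have "equivp (\<lambda>x y. (x \<in> V a k n) = (y \<in> V a k n))"
    by (auto intro!: equivpI reflpI sympI transpI)
  from Gamma_rel [OF this assms] show ?thesis
    using vieta_in_V profile_eq_V by blast
qed

lemma group_action_Gamma: "group_action (Gamma a n) (V a k n) (\<lambda>g. restrict g (V a k n))"
proof -
  have "Gamma a n = (BijGroup (Zn n))\<lparr>carrier := carrier (Gamma a n)\<rparr>"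
    by (simp add: Gamma_def)
  then show ?thesis
    using group_action_restrict [OF subgroup_Gamma [of a n] V_subset_Zn [of a k n]] Gamma_V
    by metis
qed

lemma descent_vieta:
  assumes a: "a > 0" and i: "i < n" and x: "x \<in> Zn n"
  shows "equivclp (descent a) (profile x) (profile (vieta a n i x))"
proof -
  define y where "y = x[i := partner a x i]"
  have l: "i < length x" using i x by (simp add: Zn_def)
  have y: "vieta a n i x = y" "length y = length x" "y ! i = partner a x i" "partner a y i = x ! i" "x = y[i := x ! i]"
    using i x by (auto simp: Zn_def y_def vieta_eq partner_def)
  consider "\<bar>y ! i\<bar> < \<bar>x ! i\<bar>" | "\<bar>x ! i\<bar> < \<bar>y ! i\<bar>" | "\<bar>x ! i\<bar> = \<bar>y ! i\<bar>"
    by linarith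
  then show ?thesis
  proof cases
    case 1
    then have "descent a (profile x) (profile y)"
      using l y y_def by (auto simp: descent_def)
    then show ?thesis using y by auto
  next
    case 2
    then have "descent a (profile y) (profile x)"
      using l y unfolding descent_def by metis
    then show ?thesis using y by auto
  next
    case 3
    then have "map abs y = (map abs x)[i := \<bar>x ! i\<bar>]"
      using y(3) by (simp add: y_def map_update)
    also have "\<dots> = map abs x"
      by (metis list_update_id map_update)
    finally have "mset (map abs y) = mset (map abs x)"
      by simp
    moreover have "prod_list y = prod_list x"
    proof -
      define r where "r = prod_list (x[i := 1])"
      have "a * r - x ! i = y ! i"
        using y(3) by (simp add: partner_def r_def)
      then have "(a * r - x ! i)\<^sup>2 = (x ! i)\<^sup>2"
        using 3 by (metis power2_abs)
      then have "a * (r * (a * r - 2 * x ! i)) = 0"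
        by (simp add: power2_eq_square algebra_simps)
      then have "r = 0 \<or> a * r - x ! i = x ! i"
        using a by auto
      moreover have "prod_list y = (a * r - x ! i) * r"
        using prod_list_update [OF l, of "partner a x i"] by (simp add: y_def partner_def r_def)
      ultimately show ?thesis
        using prod_list_remove [OF l] by (metis mult_zero_right r_def)
    qed
    ultimately have "profile x = profile y"
      by (simp add: profile_eq_iff)
    then show ?thesis using y by simp
  qed
qed

lemma Gamma_equivclp_descent:
  assumes "a > 0" "g \<in> carrier (Gamma a n)" "x \<in> Zn n"
  shows "equivclp (descent a) (profile x) (profile (g x))"
proof (rule Gamma_rel [OF _ assms(2,3)])
  show "equivp (\<lambda>x y. equivclp (descent a) (profile x) (profile y))"
    by (auto intro!: equivpI reflpI sympI transpI intro: equivclp_sym equivclp_trans)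
qed (use descent_vieta assms in auto)

subsection \<open>Canonical and reduced points\<close>

definition canonical :: "int list \<Rightarrow> bool" where
  "canonical x \<longleftrightarrow> sorted (x[0 := \<bar>x ! 0\<bar>])"

definition reduced :: "int \<Rightarrow> int list \<Rightarrow> bool" where
  "reduced a x \<longleftrightarrow> (\<forall>q. \<not> descent a (profile x) q)"

lemma canonical_Cons: "canonical (u # v) \<longleftrightarrow> sorted (\<bar>u\<bar> # v)"
  by (simp add: canonical_def)

lemma canonical_map_abs:
  assumes "canonical (u # v)"
  shows "map abs (u # v) = \<bar>u\<bar> # v"
proof -
  have "0 \<le> w" if "w \<in> set v" for w
    using assms that by (force simp: canonical_Cons)
  then show ?thesis
    by (auto intro: map_idI)
qed

lemma canonical_unique:
  assumes "canonical x" "canonical y" "profile x = profile y"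
  shows "x = y"
proof (cases x)
  case Nil
  then show ?thesis
    using profile_eq_lengthD [OF assms(3)] by simp
next
  case x: (Cons u v)
  then obtain u' v' where y: "y = u' # v'"
    using profile_eq_lengthD [OF assms(3)] by (cases y) auto
  have "\<bar>u\<bar> # v = \<bar>u'\<bar> # v'"
  proof -
    have "mset (\<bar>u\<bar> # v) = mset (\<bar>u'\<bar> # v')"
      using assms unfolding x y profile_eq_iff by (metis canonical_map_abs)
    moreover have "sorted (\<bar>u\<bar> # v)" "sorted (\<bar>u'\<bar> # v')"
      using assms by (simp_all only: x y canonical_Cons)
    ultimately show ?thesis
      by (metis properties_for_sort)
  qed
  then have v: "v' = v" "\<bar>u'\<bar> = \<bar>u\<bar>"
    by auto
  have "u = u'"
  proof (cases "prod_list v = 0")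
    case True
    then have "0 \<in> set v"
      by (simp add: prod_list_zero_iff)
    then show ?thesis
      using assms(1) v by (auto simp: x canonical_Cons)
  next
    case False
    then show ?thesis
      using assms(3) v by (simp add: x y profile_eq_iff)
  qed
  then show ?thesis
    by (simp add: x y v)
qed

lemma canonical_exists:
  assumes "x \<noteq> []"
  obtains d where "canonical d" "profile d = profile x"
proof -
  define s where "s = sort (map abs x)"
  have s: "sorted s" "mset s = mset (map abs x)"
    by (simp_all add: s_def)
  have "\<forall>w\<in>set s. 0 \<le> w"
    by (simp add: s_def)
  then have abs_s: "map abs s = s"
    by (auto intro: map_idI)
  have ps: "prod_list s = \<bar>prod_list x\<bar>"
    using s by (metis abs_prod_list prod_mset_prod_list)
  obtain u v where uv: "s = u # v"
    using assms s by (cases s) auto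
  show ?thesis
  proof (cases "0 \<le> prod_list x")
    case True
    then show ?thesis
      using s abs_s ps uv by (intro that [of s]) (auto simp: canonical_Cons profile_eq_iff)
  next
    case False
    then show ?thesis
      using s abs_s ps uv by (intro that [of "- u # v"]) (auto simp: canonical_Cons profile_eq_iff)
  qed
qed

lemma reduced_iff:
  assumes a: "a > 0"
  shows "reduced a x \<longleftrightarrow> prod_list x \<le> 0 \<or> (\<forall>w\<in>set x. 2 * w\<^sup>2 \<le> a * prod_list x)"
proof -
  have "(\<exists>q. descent a (profile x) q) \<longleftrightarrow> (\<exists>i<length x. \<bar>partner a x i\<bar> < \<bar>x ! i\<bar>)"
    unfolding descent_def by (metis profile_partner_transport)
  also have "\<dots> \<longleftrightarrow> 0 < prod_list x \<and> (\<exists>w\<in>set x. a * prod_list x < 2 * w\<^sup>2)"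
    using partner_less_iff [OF a] by (metis in_set_conv_nth)
  finally show ?thesis
    by (auto simp: reduced_def not_less)
qed

lemma prod_list_eq_1_imp_replicate:
  assumes "\<forall>w\<in>set v. 1 \<le> w" "prod_list v = (1 :: int)"
  shows "v = replicate (length v) 1"
  using assms
proof (induction v)
  case (Cons w v)
  then have "w = 1" "prod_list v = 1"
    using pos_zmult_eq_1_iff [of w "prod_list v"] by auto
  with Cons show ?case by simp
qed simp

lemma sorted_prod_list_eq_2_imp:
  assumes "sorted v" "\<forall>w\<in>set v. 1 \<le> w" "prod_list v = (2 :: int)"
  shows "v = replicate (length v - 1) 1 @ [2]"
  using assms
proof (induction v)
  case (Cons w v)
  have "w dvd 2"
    using Cons.prems by (metis dvd_triv_left prod_list.Cons)
  then have "w \<le> 2"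
    by (simp add: zdvd_imp_le)
  then consider "w = 1" | "w = 2"
    using Cons.prems by fastforce
  then show ?case
  proof cases
    case 1
    then have "v = replicate (length v - 1) 1 @ [2]"
      using Cons by simp
    moreover from this have "v \<noteq> []" by auto
    then have "replicate (length v) (1 :: int) = 1 # replicate (length v - 1) 1"
      by (cases v) auto
    ultimately show ?thesis
      using 1 by simp
  next
    case 2
    then have "v = replicate (length v) 1"
      using Cons.prems by (intro prod_list_eq_1_imp_replicate) auto
    moreover have "\<forall>w\<in>set v. 2 \<le> w"
      using Cons.prems 2 by simp
    ultimately have "v = []"
      by (cases v) auto
    then show ?thesis
      using 2 by simp
  qed
qed simp

lemma of_int_eq_sqrt_iff:
  assumes "0 \<le> s"
  shows "real_of_int s = sqrt (real_of_int m) \<longleftrightarrow> s\<^sup>2 = m"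
proof
  assume eq: "real_of_int s = sqrt (real_of_int m)"
  then have "0 \<le> real_of_int m"
    using assms by (metis of_int_0_le_iff real_sqrt_ge_0_iff)
  then have "(real_of_int s)\<^sup>2 = real_of_int m"
    by (simp add: eq)
  then show "s\<^sup>2 = m"
    by (metis of_int_eq_iff of_int_power)
next
  assume "s\<^sup>2 = m"
  then have "real_of_int m = (real_of_int s)\<^sup>2"
    by (metis of_int_power)
  then show "real_of_int s = sqrt (real_of_int m)"
    using assms by simp
qed

lemma prod_nth_less_eq_prod_list_take:
  fixes xs :: "'a :: comm_monoid_mult list"
  assumes "m \<le> length xs"
  shows "(\<Prod>i<m. xs ! i) = prod_list (take m xs)"
  using assms prod_nth_eq_prod_list [of "take m xs"] by simp

subsection \<open>The four families\<close>

context
  fixes a k u y z :: int and v :: "int list" and n :: nat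
  assumes a: "a > 0" and n: "n = length v + 3"
begin

lemma split_in_V:
  "u # v @ [y, z] \<in> V a k n \<longleftrightarrow>
    u\<^sup>2 + (\<Sum>w\<leftarrow>v. w\<^sup>2) + y\<^sup>2 + z\<^sup>2 - a * (u * prod_list v) * y * z = k"
  by (auto simp: V_iff n algebra_simps)

lemma split_pos:
  assumes c: "canonical (u # v @ [y, z])" and Q: "u \<noteq> 0"
  shows "\<forall>w\<in>set (\<bar>u\<bar> # v). 1 \<le> w" "prod_list (\<bar>u\<bar> # v) = \<bar>u * prod_list v\<bar>"
proof -
  show pos: "\<forall>w\<in>set (\<bar>u\<bar> # v). 1 \<le> w"
    using c Q by (fastforce simp: canonical_Cons)
  have "map abs v = v"
    using pos by (intro map_idI) auto
  then show "prod_list (\<bar>u\<bar> # v) = \<bar>u * prod_list v\<bar>"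
    by (simp add: abs_mult abs_prod_list)
qed

lemma ones_head:
  assumes "\<bar>u\<bar> # v = replicate (n - 2) 1"
  shows "canonical (u # v @ [y, z]) \<longleftrightarrow> 1 \<le> y \<and> y \<le> z"
    "u\<^sup>2 + (\<Sum>w\<leftarrow>v. w\<^sup>2) = int n - 2" "prod_list v = 1" "u = 1 \<or> u = - 1"
proof -
  have uv: "\<bar>u\<bar> = 1" "v = replicate (n - 3) 1"
    using assms by (simp_all add: n)
  then show "canonical (u # v @ [y, z]) \<longleftrightarrow> 1 \<le> y \<and> y \<le> z"
    "prod_list v = 1" "u = 1 \<or> u = - 1"
    by (auto simp: canonical_Cons sorted_append)
  have "u\<^sup>2 = 1"
    using uv(1) by (metis one_power2 power2_abs)
  moreover have "(\<Sum>w\<leftarrow>v. w\<^sup>2) = int n - 3"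
    by (subst uv(2)) (simp add: sum_list_replicate n)
  ultimately show "u\<^sup>2 + (\<Sum>w\<leftarrow>v. w\<^sup>2) = int n - 2"
    by simp
qed

lemma ones_head_iff:
  assumes c: "canonical (u # v @ [y, z])"
  shows "\<bar>u * prod_list v\<bar> = 1 \<longleftrightarrow> \<bar>u\<bar> # v = replicate (n - 2) 1"
proof
  assume Q: "\<bar>u * prod_list v\<bar> = 1"
  then have "u \<noteq> 0" by auto
  then show "\<bar>u\<bar> # v = replicate (n - 2) 1"
    using prod_list_eq_1_imp_replicate [of "\<bar>u\<bar> # v"] split_pos [OF c] Q by (simp add: n)
next
  assume "\<bar>u\<bar> # v = replicate (n - 2) 1"
  then show "\<bar>u * prod_list v\<bar> = 1"
    using ones_head by auto
qed

lemma two_head: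
  assumes "\<bar>u\<bar> # v = replicate (n - 3) 1 @ [2]"
  shows "canonical (u # v @ [y, z]) \<longleftrightarrow> 2 \<le> y \<and> y \<le> z"
    "u\<^sup>2 + (\<Sum>w\<leftarrow>v. w\<^sup>2) = int n + 1" "\<bar>u\<bar> * prod_list v = 2"
proof -
  have "canonical (u # v @ [y, z]) \<longleftrightarrow> sorted ((\<bar>u\<bar> # v) @ [y, z])"
    by (simp add: canonical_Cons)
  also have "\<dots> \<longleftrightarrow> 2 \<le> y \<and> y \<le> z"
    unfolding assms by (auto simp: sorted_append)
  finally show "canonical (u # v @ [y, z]) \<longleftrightarrow> 2 \<le> y \<and> y \<le> z" .
  have "(\<Sum>w\<leftarrow>\<bar>u\<bar> # v. w\<^sup>2) = int n + 1"
    unfolding assms by (simp add: sum_list_replicate n)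
  then show "u\<^sup>2 + (\<Sum>w\<leftarrow>v. w\<^sup>2) = int n + 1"
    by simp
  have "prod_list (\<bar>u\<bar> # v) = 2"
    unfolding assms by simp
  then show "\<bar>u\<bar> * prod_list v = 2"
    by simp
qed

lemma two_head_iff:
  assumes c: "canonical (u # v @ [y, z])"
  shows "\<bar>u * prod_list v\<bar> = 2 \<longleftrightarrow> \<bar>u\<bar> # v = replicate (n - 3) 1 @ [2]"
proof
  assume Q: "\<bar>u * prod_list v\<bar> = 2"
  then have "u \<noteq> 0" by auto
  moreover have "sorted (\<bar>u\<bar> # v)"
    using c by (auto simp: canonical_Cons sorted_append)
  ultimately show "\<bar>u\<bar> # v = replicate (n - 3) 1 @ [2]"
    using sorted_prod_list_eq_2_imp [of "\<bar>u\<bar> # v"] split_pos [OF c] Q by (simp add: n)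
next
  assume h: "\<bar>u\<bar> # v = replicate (n - 3) 1 @ [2]"
  then have "u \<noteq> 0"
    using two_head(3) by auto
  then show "\<bar>u * prod_list v\<bar> = 2"
    using split_pos(2) [OF c] two_head(3) [OF h] by simp
qed

lemma split_reduced_iff:
  assumes c: "canonical (u # v @ [y, z])"
  defines "Q \<equiv> a * (u * prod_list v)"
  shows "reduced a (u # v @ [y, z]) \<longleftrightarrow> Q \<le> 0 \<or> 2 * z \<le> Q * y"
proof (cases "u = 0")
  case True
  then show ?thesis
    by (simp add: reduced_iff [OF a] Q_def)
next
  case False
  have pos: "0 < w" if "w \<in> set (v @ [y, z])" for w
    using c False that by (fastforce simp: canonical_Cons)
  then have yz: "0 < y" "0 < z" by auto
  have P: "a * prod_list (u # v @ [y, z]) = Q * y * z"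
    by (simp add: Q_def)
  then have sgn: "prod_list (u # v @ [y, z]) \<le> 0 \<longleftrightarrow> Q \<le> 0"
    using a yz by (metis linorder_not_less mult_pos_pos zero_less_mult_pos zero_less_mult_pos2)
  have "(\<forall>w\<in>set (u # v @ [y, z]). 2 * w\<^sup>2 \<le> Q * y * z) \<longleftrightarrow> 2 * z\<^sup>2 \<le> Q * y * z"
  proof
    assume z: "2 * z\<^sup>2 \<le> Q * y * z"
    show "\<forall>w\<in>set (u # v @ [y, z]). 2 * w\<^sup>2 \<le> Q * y * z"
    proof
      fix w assume "w \<in> set (u # v @ [y, z])"
      then have "\<bar>w\<bar> \<le> z"
        using c pos by (fastforce simp: canonical_Cons sorted_append)
      then have "w\<^sup>2 \<le> z\<^sup>2"
        using abs_le_square_iff [of w z] by simp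
      then show "2 * w\<^sup>2 \<le> Q * y * z"
        using z by linarith
    qed
  qed simp
  also have "\<dots> \<longleftrightarrow> z * (2 * z) \<le> z * (Q * y)"
    by (simp add: power2_eq_square ac_simps)
  also have "\<dots> \<longleftrightarrow> 2 * z \<le> Q * y"
    using yz by (simp only: mult_le_cancel_left_pos)
  finally show ?thesis
    using sgn by (simp only: reduced_iff [OF a] P)
qed

lemma split_in_S0_iff:
  "u # v @ [y, z] \<in> S0 a k n \<longleftrightarrow>
    u # v @ [y, z] \<in> V a k n \<and> canonical (u # v @ [y, z]) \<and> a * (u * prod_list v) = 0"
proof -
  have "u = 0" if "canonical (u # v @ [y, z])" "u * prod_list v = 0"
  proof (rule ccontr)
    assume "u \<noteq> 0"
    then have "0 \<in> set v"
      using that by (simp add: prod_list_zero_iff)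
    then show False
      using that \<open>u \<noteq> 0\<close> by (auto simp: canonical_Cons)
  qed
  then show ?thesis
    using a by (auto simp: S0_def V_iff n canonical_Cons)
qed

lemma split_in_S_gt2_iff:
  defines "Q \<equiv> a * (u * prod_list v)"
  shows "u # v @ [y, z] \<in> S_gt2 a k n \<longleftrightarrow>
    u # v @ [y, z] \<in> V a k n \<and> canonical (u # v @ [y, z]) \<and> (Q < - 2 \<or> 2 < Q \<and> 2 * z \<le> Q * y)"
proof -
  let ?x = "u # v @ [y, z]"
  have Q: "a * (\<Prod>i<n - 2. ?x ! i) = Q"
    using prod_nth_less_eq_prod_list_take [of "Suc (length v)" ?x]
    by (simp add: n Q_def del: prod.lessThan_Suc)
  have Qy: "a * (\<Prod>i<n - 1. ?x ! i) = Q * y"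
    using prod_nth_less_eq_prod_list_take [of "Suc (Suc (length v))" ?x]
    by (simp add: n Q_def del: prod.lessThan_Suc)
  have half: "real_of_int z \<le> real_of_int a / 2 * real_of_int p \<longleftrightarrow> 2 * z \<le> a * p" for p
  proof -
    have "real_of_int z \<le> real_of_int a / 2 * real_of_int p \<longleftrightarrow> real_of_int (2 * z) \<le> real_of_int (a * p)"
      by (simp add: field_simps)
    then show ?thesis
      by (simp only: of_int_le_iff)
  qed
  have "?x ! (n - 1) = z"
    by (simp add: n nth_append)
  then have le: "real_of_int (?x ! (n - 1)) \<le> real_of_int a / 2 * real_of_int (\<Prod>i<n - 1. ?x ! i) \<longleftrightarrow>
      2 * z \<le> Q * y"
    by (simp only: half Qy)
  have sgn: "(0 < u \<longleftrightarrow> 0 < Q) \<and> (u < 0 \<longleftrightarrow> Q < 0)" if "canonical ?x"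
  proof (cases "u = 0")
    case False
    then have "0 < w" if "w \<in> set v" for w
      using \<open>canonical ?x\<close> that by (fastforce simp: canonical_Cons)
    then have "0 < prod_list v"
      by (induction v) auto
    then show ?thesis
      using a by (auto simp: Q_def zero_less_mult_iff mult_less_0_iff)
  qed (simp add: Q_def)
  show ?thesis
  proof (cases "u < 0")
    case True
    then show ?thesis
      using sgn unfolding S_gt2_def Un_iff mem_Collect_eq Q le by (auto simp: canonical_def)
  next
    case False
    then show ?thesis
      using sgn unfolding S_gt2_def Un_iff mem_Collect_eq Q le by (auto simp: canonical_def)
  qed
qed

lemma split_eq_append_iff:
  "u # v @ [y, z] = w @ [y', z'] \<longleftrightarrow> u # v = w \<and> y = y' \<and> z = z'"
  using append_eq_append_conv [of "[y, z]" "[y', z']" "u # v" w] by auto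

lemma split_in_S1_iff:
  "u # v @ [y, z] \<in> S1 a k n \<longleftrightarrow>
    u # v @ [y, z] \<in> V a k n \<and> canonical (u # v @ [y, z]) \<and> a * (u * prod_list v) = - 1"
proof -
  have "u # v = - 1 # replicate (n - 3) 1 \<longleftrightarrow> u < 0 \<and> \<bar>u\<bar> # v = replicate (n - 2) 1"
    by (auto simp: n)
  then have "u # v @ [y, z] \<in> S1 a k n \<longleftrightarrow>
      a = 1 \<and> u < 0 \<and> \<bar>u\<bar> # v = replicate (n - 2) 1 \<and>
      1 \<le> y \<and> y \<le> z \<and> y\<^sup>2 + z\<^sup>2 + y * z = k - int n + 2"
    using split_eq_append_iff [of "- 1 # replicate (n - 3) 1"] by (auto simp: S1_def)
  also have "\<dots> \<longleftrightarrow> a = 1 \<and> u * prod_list v = - 1 \<and> canonical (u # v @ [y, z]) \<and> u # v @ [y, z] \<in> V a k n"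
    using ones_head ones_head_iff by (auto simp: split_in_V)
  finally have "u # v @ [y, z] \<in> S1 a k n \<longleftrightarrow>
      a = 1 \<and> u * prod_list v = - 1 \<and> canonical (u # v @ [y, z]) \<and> u # v @ [y, z] \<in> V a k n" .
  moreover have "a = 1 \<and> u * prod_list v = - 1 \<longleftrightarrow> a * (u * prod_list v) = - 1"
    using a pos_zmult_eq_1_iff [of a "- (u * prod_list v)"] by auto
  ultimately show ?thesis by blast
qed

lemma split_in_S2_iff:
  "u # v @ [y, z] \<in> S2 a k n \<longleftrightarrow>
    u # v @ [y, z] \<in> V a k n \<and> canonical (u # v @ [y, z]) \<and>
    (a * (u * prod_list v) = - 2 \<or> a * (u * prod_list v) = 2 \<and> y = z)"
  (is "?x \<in> _ \<longleftrightarrow> ?R")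
proof -
  consider "a = 1" | "a = 2" | "a > 2"
    using a by linarith
  then show ?thesis
  proof cases
    case 1
    let ?h = "\<bar>u\<bar> # v = replicate (n - 3) 1 @ [2]"
    have pos: "u # v = replicate (n - 3) 1 @ [2] \<longleftrightarrow> 0 < u \<and> ?h"
      by (cases "n - 3") auto
    have neg: "u # v = (if n = 3 then [- 2] else - 1 # replicate (n - 4) 1 @ [2]) \<longleftrightarrow> u < 0 \<and> ?h"
      using n by (cases "n - 3") auto
    have "?x \<in> S2 a k n \<longleftrightarrow> (0 < u \<and> ?h \<and> y = z \<and> 2 \<le> y \<and> k = int n + 1) \<or>
        (u < 0 \<and> ?h \<and> 2 \<le> y \<and> y \<le> z \<and> real_of_int (y + z) = sqrt (real_of_int (k - int n - 1)))"
      unfolding pos [symmetric] neg [symmetric] conj_assoc [symmetric]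
      using 1 split_eq_append_iff by (auto simp: S2_def)
    also have "\<dots> \<longleftrightarrow> ?R"
    proof (cases ?h)
      case True
      have V: "?x \<in> V a k n \<longleftrightarrow> int n + 1 + y\<^sup>2 + z\<^sup>2 - u * prod_list v * y * z = k"
        using 1 split_in_V two_head(2) [OF True] by simp
      have "u \<noteq> 0"
        using two_head(3) [OF True] by auto
      then consider "0 < u" "u * prod_list v = 2" | "u < 0" "u * prod_list v = - 2"
        using two_head(3) [OF True] by (cases "0 < u") auto
      then show ?thesis
      proof cases
        case 1
        then show ?thesis
          unfolding V two_head(1) [OF True] using True \<open>a = 1\<close> by (auto simp: power2_eq_square)
      next
        case 2
        then show ?thesis
          unfolding V two_head(1) [OF True] using True \<open>a = 1\<close>
          by (auto simp: of_int_eq_sqrt_iff power2_eq_square algebra_simps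
              simp del: of_int_add of_int_diff)
      qed
    next
      case False
      then have "\<not> ?R"
        using two_head_iff 1 by auto
      with False show ?thesis by blast
    qed
    finally show ?thesis .
  next
    case 2
    let ?h = "\<bar>u\<bar> # v = replicate (n - 2) 1"
    have pos: "u # v = replicate (n - 2) 1 \<longleftrightarrow> 0 < u \<and> ?h"
      by (auto simp: n)
    have neg: "u # v = - 1 # replicate (n - 3) 1 \<longleftrightarrow> u < 0 \<and> ?h"
      by (auto simp: n)
    have "?x \<in> S2 a k n \<longleftrightarrow> (0 < u \<and> ?h \<and> y = z \<and> 1 \<le> y \<and> k = int n - 2) \<or>
        (u < 0 \<and> ?h \<and> 1 \<le> y \<and> y \<le> z \<and> real_of_int (y + z) = sqrt (real_of_int (k - int n + 2)))"
      unfolding pos [symmetric] neg [symmetric] conj_assoc [symmetric]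
      using 2 split_eq_append_iff split_eq_append_iff [of "- 1 # replicate (n - 3) 1"]
      by (auto simp: S2_def)
    also have "\<dots> \<longleftrightarrow> ?R"
    proof (cases ?h)
      case True
      have V: "?x \<in> V a k n \<longleftrightarrow> int n - 2 + y\<^sup>2 + z\<^sup>2 - 2 * u * y * z = k"
        using 2 split_in_V ones_head(2,3) [OF True] by simp
      from ones_head(4) [OF True] show ?thesis
      proof
        assume "u = 1"
        then show ?thesis
          unfolding V ones_head(1,3) [OF True] using True \<open>a = 2\<close> by (auto simp: power2_eq_square)
      next
        assume "u = - 1"
        then show ?thesis
          unfolding V ones_head(1,3) [OF True] using True \<open>a = 2\<close>
          by (auto simp: of_int_eq_sqrt_iff power2_eq_square algebra_simps
              simp del: of_int_add of_int_diff)
      qed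
    next
      case False
      then have "\<not> ?R"
        using ones_head_iff 2 by auto
      with False show ?thesis by blast
    qed
    finally show ?thesis .
  next
    case 3
    then have "\<not> a dvd 2" "\<not> a dvd - 2"
      using zdvd_imp_le by fastforce+
    then have "a * m \<noteq> 2" "a * m \<noteq> - 2" for m
      by (metis dvd_triv_left)+
    then show ?thesis
      using 3 by (simp add: S2_def)
  qed
qed

end

lemma fundamental_set_iff:
  assumes a: "a > 0" and n: "n \<ge> 3"
  shows "x \<in> S0 a k n \<union> S1 a k n \<union> S2 a k n \<union> S_gt2 a k n \<longleftrightarrow>
    x \<in> V a k n \<and> canonical x \<and> reduced a x"
proof (cases "length x = n")
  case True
  then obtain u v y z where x: "x = u # v @ [y, z]" and l: "n = length v + 3"
  proof -
    have "drop (n - 2) x = [x ! (n - 2), x ! (n - 1)]"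
      using True n by (intro nth_equalityI) (auto simp: less_2_cases_iff)
    moreover have "take (n - 2) x = x ! 0 # take (n - 3) (tl x)"
      using True n by (cases x) (auto simp: take_Cons')
    ultimately have "x = x ! 0 # take (n - 3) (tl x) @ [x ! (n - 2), x ! (n - 1)]"
      by (metis append_Cons append_take_drop_id)
    then show ?thesis
      using that True n by simp
  qed
  define Q where "Q = a * (u * prod_list v)"
  have R: "reduced a x \<longleftrightarrow> Q = 0 \<or> Q = - 1 \<or> (Q = - 2 \<or> Q = 2 \<and> y = z) \<or>
      (Q < - 2 \<or> 2 < Q \<and> 2 * z \<le> Q * y)" (is "_ \<longleftrightarrow> ?R") if c: "canonical x"
  proof -
    have "reduced a x \<longleftrightarrow> Q \<le> 0 \<or> 2 * z \<le> Q * y"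
      using split_reduced_iff [OF a l] c unfolding x Q_def .
    also have "\<dots> \<longleftrightarrow> ?R"
    proof (cases "0 < Q")
      case True
      then have "u \<noteq> 0"
        by (auto simp: Q_def)
      then have yz: "0 < y" "y \<le> z"
        using c by (auto simp: x canonical_Cons sorted_append)
      consider "Q = 1" | "Q = 2" | "2 < Q"
        using True by linarith
      then show ?thesis
        by cases (use yz in auto)
    next
      case False
      then show ?thesis by auto
    qed
    finally show ?thesis .
  qed
  have distrib: "((v \<and> c \<and> A \<or> v \<and> c \<and> B) \<or> v \<and> c \<and> C) \<or> v \<and> c \<and> D \<longleftrightarrow>
      v \<and> c \<and> (A \<or> B \<or> C \<or> D)" for v c A B C D
    by blast
  have "x \<in> S0 a k n \<union> S1 a k n \<union> S2 a k n \<union> S_gt2 a k n \<longleftrightarrow> x \<in> V a k n \<and> canonical x \<and> ?R"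
    unfolding Un_iff x Q_def split_in_S0_iff [OF a l] split_in_S1_iff [OF a l]
      split_in_S2_iff [OF a l] split_in_S_gt2_iff [OF a l]
    by (rule distrib)
  then show ?thesis
    using R by (simp cong: conj_cong)
next
  case False
  then show ?thesis
    using n by (auto simp: S0_def S1_def S2_def S_gt2_def V_iff split: if_splits)
qed

subsection \<open>Reachability within an orbit\<close>

definition reachable :: "int \<Rightarrow> nat \<Rightarrow> int list \<Rightarrow> int list \<Rightarrow> bool" where
  "reachable a n x y \<longleftrightarrow> (\<exists>g\<in>carrier (Gamma a n). g x = y)"

lemma reachable_generator: "h \<in> Gamma_generators a n \<Longrightarrow> reachable a n x (h x)"
  unfolding reachable_def carrier_Gamma by (blast intro: generate.incl)

lemma reachable_refl: "x \<in> Zn n \<Longrightarrow> reachable a n x x"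
  unfolding reachable_def carrier_Gamma
  by (rule bexI [OF _ generate.one]) (simp add: BijGroup_simps)

lemma reachable_trans:
  assumes "x \<in> Zn n" "reachable a n x y" "reachable a n y z"
  shows "reachable a n x z"
proof -
  obtain g h where gh: "g \<in> carrier (Gamma a n)" "g x = y" "h \<in> carrier (Gamma a n)" "h y = z"
    using assms by (auto simp: reachable_def)
  have "g \<in> Bij (Zn n)" "h \<in> Bij (Zn n)"
    using gh subgroup.subset [OF subgroup_Gamma] by (auto simp: BijGroup_simps)
  then have "(h \<otimes>\<^bsub>BijGroup (Zn n)\<^esub> g) x = z"
    using gh assms by (simp add: BijGroup_simps compose_eq)
  then show ?thesis
    using gh subgroup.m_closed [OF subgroup_Gamma] unfolding reachable_def by blast
qed

lemma reachable_vieta: "i < n \<Longrightarrow> x \<in> Zn n \<Longrightarrow> reachable a n x (vieta a n i x)"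
  using reachable_generator [of "restrict (vieta a n i) (Zn n)" a n x]
  by (auto simp: Gamma_generators_def)

lemma reachable_permute_list:
  "\<sigma> permutes {..<n} \<Longrightarrow> x \<in> Zn n \<Longrightarrow> reachable a n x (permute_list \<sigma> x)"
  using reachable_generator [of "restrict (permute_list \<sigma>) (Zn n)" a n x]
  by (auto simp: Gamma_generators_def)

lemma reachable_double_sign:
  assumes "s < n" "t < n" "s \<noteq> t" "x \<in> Zn n"
  shows "reachable a n x (double_sign s t x)"
proof -
  have "reachable a n x (double_sign s t x)" if "s < t" "t < n" for s t
    using reachable_generator [of "restrict (double_sign s t) (Zn n)" a n x] that assms(4)
    by (auto simp: Gamma_generators_def)
  moreover have "double_sign s t x = double_sign t s x"
    using assms(3) by (simp add: double_sign_def list_update_swap)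
  ultimately show ?thesis
    using assms by (metis linorder_neqE_nat)
qed

lemma reachable_if_map_abs_eq:
  assumes "x \<in> Zn n" "map abs x = map abs y" "prod_list x = prod_list y"
  shows "reachable a n x y"
  using assms
proof (induction "card {i. i < n \<and> x ! i \<noteq> y ! i}" arbitrary: x rule: less_induct)
  case less
  have lx: "length x = n" and ly: "length y = n"
    using less.prems by (auto simp: Zn_def dest: map_eq_imp_length_eq)
  have abs_eq: "\<bar>x ! i\<bar> = \<bar>y ! i\<bar>" if "i < n" for i
    using less.prems(2) that lx ly by (metis nth_map)
  show ?case
  proof (cases "\<exists>i<n. x ! i \<noteq> y ! i")
    case False
    then have "x = y"
      using lx ly by (intro nth_equalityI) auto
    then show ?thesis
      using less.prems by (simp add: reachable_refl)
  next
    case True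
    then obtain i where i: "i < n" "x ! i \<noteq> y ! i" by auto
    then have yi: "y ! i = - (x ! i)"
      using abs_eq [of i] by (auto simp: abs_eq_iff)
    obtain j where j: "j < n" "j \<noteq> i" "y ! j = - (x ! j)"
    proof (cases "\<exists>j<n. j \<noteq> i \<and> x ! j \<noteq> y ! j")
      case True
      then show ?thesis
        using that abs_eq by (metis abs_eq_iff)
    next
      case False
      then have y: "y = x[i := - (x ! i)]"
        using lx ly yi i by (intro nth_equalityI) (auto simp: nth_list_update)
      have "- (x ! i) * prod_list (x[i := 1]) = x ! i * prod_list (x[i := 1])"
        using less.prems(3) i lx prod_list_update [of i x "- (x ! i)"] prod_list_remove [of i x]
        by (simp add: y)
      then have "prod_list (x[i := 1]) = 0"
        using i yi by simp
      then obtain j where "j < n" "x[i := 1] ! j = 0"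
        using lx by (auto simp: prod_list_zero_iff in_set_conv_nth)
      moreover from this have "j \<noteq> i"
        using lx by auto
      ultimately show ?thesis
        using that [of j] abs_eq [of j] by simp
    qed
    define x' where "x' = double_sign i j x"
    have x': "x' ! l = (if l = i \<or> l = j then y ! l else x ! l)" if "l < n" for l
      using that yi j lx by (auto simp: x'_def double_sign_def nth_list_update)
    have x'_Zn: "x' \<in> Zn n"
      by (simp add: x'_def double_sign_def Zn_def lx)
    have "{l. l < n \<and> x' ! l \<noteq> y ! l} \<subset> {l. l < n \<and> x ! l \<noteq> y ! l}"
    proof
      show "{l. l < n \<and> x' ! l \<noteq> y ! l} \<subseteq> {l. l < n \<and> x ! l \<noteq> y ! l}"
        using x' by (auto split: if_splits)
      have "i \<in> {l. l < n \<and> x ! l \<noteq> y ! l}" "i \<notin> {l. l < n \<and> x' ! l \<noteq> y ! l}"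
        using i x' by auto
      then show "{l. l < n \<and> x' ! l \<noteq> y ! l} \<noteq> {l. l < n \<and> x ! l \<noteq> y ! l}"
        by blast
    qed
    then have "card {l. l < n \<and> x' ! l \<noteq> y ! l} < card {l. l < n \<and> x ! l \<noteq> y ! l}"
      by (intro psubset_card_mono) auto
    moreover have "map abs x' = map abs y"
      using x' abs_eq x'_Zn ly by (intro nth_equalityI) (auto simp: Zn_def)
    moreover have "prod_list x' = prod_list y"
    proof -
      have "double_sign i j x = double_sign j i x"
        using j by (simp add: double_sign_def list_update_swap)
      then have "profile x' = profile x"
        unfolding x'_def using i j less.prems(1) profile_double_sign by (metis linorder_neqE_nat)
      then show ?thesis
        using less.prems(3) by (simp add: profile_eq_iff)
    qed
    ultimately have "reachable a n x' y"
      using less.hyps x'_Zn by blast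
    then show ?thesis
      using reachable_trans reachable_double_sign [of i n j x a] i j less.prems(1)
      unfolding x'_def by metis
  qed
qed

lemma reachable_if_profile_eq:
  assumes x: "x \<in> Zn n" and eq: "profile x = profile y"
  shows "reachable a n x y"
proof -
  have l: "length x = n"
    using x by (simp add: Zn_def)
  obtain \<sigma> where \<sigma>: "\<sigma> permutes {..<length (map abs x)}" "permute_list \<sigma> (map abs x) = map abs y"
    using eq by (metis mset_eq_permutation profile_eq_iff)
  then have \<sigma>n: "\<sigma> permutes {..<n}"
    by (simp add: l)
  have "map abs (permute_list \<sigma> x) = map abs y"
    using \<sigma> \<sigma>n by (metis l permute_list_map)
  moreover have "prod_list (permute_list \<sigma> x) = prod_list y"
    using profile_permute_list [OF \<sigma>n x] eq by (simp add: profile_eq_iff)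
  moreover have "permute_list \<sigma> x \<in> Zn n"
    by (simp add: Zn_def l)
  ultimately show ?thesis
    using reachable_trans x reachable_permute_list [OF \<sigma>n x] reachable_if_map_abs_eq by metis
qed

lemma reachable_canonical_reduced:
  assumes "x \<in> Zn n" "n > 0"
  obtains d where "reachable a n x d" "canonical d" "reduced a d"
proof -
  have "\<exists>d. reachable a n x d \<and> canonical d \<and> reduced a d"
    using assms(1)
  proof (induction "nat (sum_list (map abs x))" arbitrary: x rule: less_induct)
    case less
    show ?case
    proof (cases "reduced a x")
      case True
      have "x \<noteq> []"
        using less.prems assms(2) by (auto simp: Zn_def)
      then obtain d where "canonical d" "profile d = profile x"
        using canonical_exists by blast
      then show ?thesis
        using True less.prems reachable_if_profile_eq [of x n d a] by (auto simp: reduced_def)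
    next
      case False
      then obtain i where i: "i < length x" "\<bar>partner a x i\<bar> < \<bar>x ! i\<bar>"
        unfolding reduced_def descent_def by (metis profile_partner_transport)
      define y where "y = vieta a n i x"
      have y: "y = x[i := partner a x i]" "i < n"
        using i less.prems by (auto simp: y_def Zn_def vieta_eq)
      have "sum_list (map abs (x[i := e])) = \<bar>e\<bar> + sum_list (map abs (x[i := 0]))" for e
        using i by (simp add: upd_conv_take_nth_drop)
      from this [of "x ! i"] this [of "partner a x i"]
      have "sum_list (map abs y) < sum_list (map abs x)"
        using i(2) by (simp add: y)
      moreover have "0 \<le> sum_list (map abs y)"
        by (intro sum_list_nonneg) auto
      ultimately have "nat (sum_list (map abs y)) < nat (sum_list (map abs x))"
        by linarith
      moreover have "y \<in> Zn n"
        using less.prems by (simp add: y Zn_def)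
      ultimately obtain d where "reachable a n y d" "canonical d" "reduced a d"
        using less.hyps by blast
      then show ?thesis
        using reachable_trans less.prems reachable_vieta [OF y(2) less.prems] unfolding y_def by blast
    qed
  qed
  then show ?thesis
    using that by blast
qed

theorem theorem1p1:
  fixes a k :: int and n :: nat
  assumes "a > 0" and "n \<ge> 3"
  shows "group_action (Gamma a n) (V a k n) (\<lambda>g. restrict g (V a k n)) \<and>
    fundamental_domain (Gamma a n) (V a k n) (\<lambda>g. restrict g (V a k n))
      (S0 a k n \<union> S1 a k n \<union> S2 a k n \<union> S_gt2 a k n)"
proof
  let ?D = "S0 a k n \<union> S1 a k n \<union> S2 a k n \<union> S_gt2 a k n"
  show "group_action (Gamma a n) (V a k n) (\<lambda>g. restrict g (V a k n))"
    by (rule group_action_Gamma)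
  note D = fundamental_set_iff [OF assms, where k = k]
  show "fundamental_domain (Gamma a n) (V a k n) (\<lambda>g. restrict g (V a k n)) ?D"
    unfolding fundamental_domain_def
  proof (intro conjI ballI)
    show "?D \<subseteq> V a k n"
      using D by blast
    fix B assume "B \<in> orbits (Gamma a n) (V a k n) (\<lambda>g. restrict g (V a k n))"
    then obtain x where x: "x \<in> V a k n" and "B = orbit (Gamma a n) (\<lambda>g. restrict g (V a k n)) x"
      by (auto simp: orbits_def)
    then have B: "B = {y. reachable a n x y}"
      by (auto simp: orbit_def reachable_def)
    have xZ: "x \<in> Zn n"
      using x V_subset_Zn by blast
    obtain d where d: "reachable a n x d" "canonical d" "reduced a d"
      using reachable_canonical_reduced xZ assms(2) by (metis gr0I not_numeral_le_zero)
    moreover have "d \<in> V a k n"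
      using d(1) x xZ Gamma_V by (auto simp: reachable_def)
    ultimately have dBD: "d \<in> B" "d \<in> ?D"
      using D B by auto
    show "\<exists>!x. x \<in> B \<and> x \<in> ?D"
    proof (rule ex1I [of _ d])
      show "d \<in> B \<and> d \<in> ?D"
        using dBD by blast
      fix e assume e: "e \<in> B \<and> e \<in> ?D"
      then have "canonical e" "reduced a e"
        using D by blast+
      have "equivclp (descent a) (profile x) (profile d)" "equivclp (descent a) (profile x) (profile e)"
        using dBD(1) e B Gamma_equivclp_descent [OF assms(1) _ xZ] by (auto simp: reachable_def)
      then have "equivclp (descent a) (profile e) (profile d)"
        by (metis equivclp_sym equivclp_trans)
      then have "profile e = profile d"
        using descent_normal_form_unique [OF assms(1)] \<open>reduced a e\<close> d(3) unfolding reduced_def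
        by blast
      then show "e = d"
        using canonical_unique \<open>canonical e\<close> d(2) by blast
    qed
  qed
qed

end
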